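(* Let $n\ge1$, let $G=(V,E)$ be a finite graph with $V=\{1,\dots,v\}$, and let $p:V\to\mathbb{R}^n$. Then: (1) $R_{P\mathbb{S}_+}(G,p)\,T_{1}(G,p)=R_{\mathbb{E}}(G,p)$, and, provided $p_i\cdot p_i\neq1$ for all $i\in V$ (so that $R_{P\mathbb{H}}(G,p)$ is defined), $R_{P\mathbb{H}}(G,p)\,T_{-1}(G,p)=R_{\mathbb{E}}(G,p)$. (2) $G(p)$ is first-order rigid in $P\mathbb{S}^n_+$ if and only if $G(p)$ is first-order rigid in $\mathbb{E}^n$ (identified with $\mathbb{R}^n$). (3) $G(p)$ is a first-order rigid framework in $P\mathbb{H}^n\cup P\mathbb{D}^n$ if and only if $G(p)$ is first-order rigid in $\mathbb{E}^n$ (identified with $\mathbb{R}^n$) and $p_i\cdot p_i\neq1$ for all $i\in V$.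
   Context: $x\cdot y$ is the standard inner product on $\mathbb{R}^n$, and edges are unordered pairs of distinct vertices. Euclidean space $\mathbb{E}^n$ is identified with $\mathbb{R}^n$. The projective models (obtained by central projection onto the hyperplane $x_{n+1}=1$ of $\mathbb{R}^{n+1}$) are $P\mathbb{S}^n_+=\mathbb{R}^n$ (spherical), $P\mathbb{H}^n=\{x\in\mathbb{R}^n:x\cdot x<1\}$ (hyperbolic) and $P\mathbb{D}^n=\{x\in\mathbb{R}^n:x\cdot x>1\}$ (exterior hyperbolic); the unit sphere $x\cdot x=1$ is the absolute and is not in $P\mathbb{H}^n\cup P\mathbb{D}^n$. A framework $G(p)$ in one of these spaces is a graph $G$ with a map $p$ from $V$ to that space; write $p_i=p(i)$. For points $x,y$ define $$k^{\mathbb{E}}(x,y)=x-y,\qquad k^{K}(x,y)=\Bigl(\frac{1+K\,x\cdot y}{1+K\,x\cdot x}\Bigr)x-y,$$ where $K=1$ for $P\mathbb{S}^n_+$ and $K=-1$ for $P\mathbb{H}^n\cup P\mathbb{D}^n$. For each of these geometries let $k$ denote the corresponding function. The rigidity matrix of $G(p)$ ($R_{\mathbb{E}}(G,p)$, $R_{P\mathbb{S}_+}(G,p)$, $R_{P\mathbb{H}}(G,p)$ for $k=k^{\mathbb{E}},k^{1},k^{-1}$ respectively; $R_{P\mathbb{H}}$ is used for vertices in $P\mathbb{H}^n\cup P\mathbb{D}^n$) is the $|E|\times nv$ matrix whose row indexed by $\{i,j\}\in E$ has the row vector $k(p_i,p_j)$ in the $n$ columns of vertex $i$, $k(p_j,p_i)$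 in the $n$ columns of vertex $j$, and $0$ elsewhere. $T_K(G,p)$ is the $nv\times nv$ block diagonal matrix with diagonal blocks $T_{p_1},\dots,T_{p_v}$, where $T_{p_i}=I+K\,p_ip_i^{\mathsf T}$ is $n\times n$, i.e. $(T_{p_i})_{ab}=\delta_{ab}+K\,p_i^{(a)}p_i^{(b)}$ with $p_i^{(a)}$ the $a$-th coordinate of $p_i$. A first-order motion of $G(p)$ in the given geometry is a map $u:V\to\mathbb{R}^n$ in the kernel of the rigidity matrix, i.e. $k(p_i,p_j)\cdot u_i+k(p_j,p_i)\cdot u_j=0$ for all $\{i,j\}\in E$. A trivial first-order motion of the geometry with point set $Y$ ($Y=\mathbb{R}^n$ for $\mathbb{E}^n$ and $P\mathbb{S}^n_+$; $Y=P\mathbb{H}^n\cup P\mathbb{D}^n$ in the hyperbolic case) is a map $w:Y\to\mathbb{R}^n$ with $k(x,y)\cdot w(x)+k(y,x)\cdot w(y)=0$ for all $x,y\in Y$. $G(p)$ is first-order rigid in the geometry if every first-order motion $u$ of $G(p)$ is of the form $u_i=w(p_i)$ for some trivial first-order motion $w$. *)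

theory Defs
  imports "HOL-Analysis.Analysis"
begin

definition graph :: "nat set \<Rightarrow> nat set set \<Rightarrow> bool" where
  "graph V E \<longleftrightarrow> E \<subseteq> {{i, j} | i j. i \<in> V \<and> j \<in> V \<and> i \<noteq> j}"

definition PS_plus :: "(real ^ 'n) set" where "PS_plus = UNIV"
definition PH :: "(real ^ 'n) set" where "PH = {x. x \<bullet> x < 1}"
definition PD :: "(real ^ 'n) set" where "PD = {x. x \<bullet> x > 1}"

text \<open>A placement is a total function whose values outside \<open>V\<close> are never used. Likewise the
  trivial motions below are total functions that are unconstrained outside the point set \<open>Y\<close>.\<close>

definition framework :: "(real ^ 'n) set \<Rightarrow> nat set \<Rightarrow> (nat \<Rightarrow> real ^ 'n) \<Rightarrow> bool" where
  "framework Y V p \<longleftrightarrow> (\<forall>i\<in>V. p i \<in> Y)"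

definition k_E :: "real ^ 'n \<Rightarrow> real ^ 'n \<Rightarrow> real ^ 'n" where
  "k_E x y = x - y"

text \<open>For \<open>K = - 1\<close> this is meaningful only off the absolute \<open>x \<bullet> x = 1\<close>, where the denominator
  is not zero.\<close>

definition k_K :: "real \<Rightarrow> real ^ 'n \<Rightarrow> real ^ 'n \<Rightarrow> real ^ 'n" where
  "k_K K x y = ((1 + K * (x \<bullet> y)) / (1 + K * (x \<bullet> x))) *\<^sub>R x - y"

text \<open>A matrix is a function of a row index and a column index, considered only on the index sets
  in question: the edges \<open>e \<in> E\<close> for the rows of a rigidity matrix, and the pairs \<open>(i, a)\<close> of a
  vertex \<open>i \<in> V\<close> and a coordinate \<open>a\<close> for its columns and for both indices of \<open>T_mat\<close>.\<close>

definition mat_eq_on ::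
  "'r set \<Rightarrow> 'c set \<Rightarrow> ('r \<Rightarrow> 'c \<Rightarrow> real) \<Rightarrow> ('r \<Rightarrow> 'c \<Rightarrow> real) \<Rightarrow> bool" where
  "mat_eq_on I J A B \<longleftrightarrow> (\<forall>r\<in>I. \<forall>c\<in>J. A r c = B r c)"

definition mat_mult_on ::
  "'m set \<Rightarrow> ('r \<Rightarrow> 'm \<Rightarrow> real) \<Rightarrow> ('m \<Rightarrow> 'c \<Rightarrow> real) \<Rightarrow> 'r \<Rightarrow> 'c \<Rightarrow> real" where
  "mat_mult_on M A B r c = (\<Sum>m\<in>M. A r m * B m c)"

definition cols :: "nat set \<Rightarrow> (nat \<times> 'n) set" where
  "cols V = V \<times> UNIV"

text \<open>For an edge \<open>e\<close> and an endpoint \<open>i \<in> e\<close>, the definite description below is the other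
  endpoint of \<open>e\<close>.\<close>

definition rigidity_matrix ::
  "(real ^ 'n \<Rightarrow> real ^ 'n \<Rightarrow> real ^ 'n) \<Rightarrow> (nat \<Rightarrow> real ^ 'n) \<Rightarrow> nat set \<Rightarrow> nat \<times> 'n \<Rightarrow> real" where
  "rigidity_matrix k p e =
     (\<lambda>(i, a). if i \<in> e then k (p i) (p (THE j. e = {i, j})) $ a else 0)"

definition T_block :: "real \<Rightarrow> real ^ 'n \<Rightarrow> real ^ 'n ^ 'n" where
  "T_block K x = (\<chi> a b. (if a = b then 1 else 0) + K * x $ a * x $ b)"

definition T_mat :: "real \<Rightarrow> (nat \<Rightarrow> real ^ 'n) \<Rightarrow> nat \<times> 'n \<Rightarrow> nat \<times> 'n \<Rightarrow> real" where
  "T_mat K p = (\<lambda>(i, a) (j, b). if i = j then T_block K (p i) $ a $ b else 0)"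

definition first_order_motion ::
  "(real ^ 'n \<Rightarrow> real ^ 'n \<Rightarrow> real ^ 'n) \<Rightarrow> nat set \<Rightarrow> nat set set \<Rightarrow>
   (nat \<Rightarrow> real ^ 'n) \<Rightarrow> (nat \<Rightarrow> real ^ 'n) \<Rightarrow> bool" where
  "first_order_motion k V E p u \<longleftrightarrow>
     (\<forall>e\<in>E. (\<Sum>(i, a)\<in>cols V. rigidity_matrix k p e (i, a) * u i $ a) = 0)"

definition trivial_motion ::
  "(real ^ 'n \<Rightarrow> real ^ 'n \<Rightarrow> real ^ 'n) \<Rightarrow> (real ^ 'n) set \<Rightarrow> (real ^ 'n \<Rightarrow> real ^ 'n) \<Rightarrow> bool" where
  "trivial_motion k Y w \<longleftrightarrow> (\<forall>x\<in>Y. \<forall>y\<in>Y. k x y \<bullet> w x + k y x \<bullet> w y = 0)"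

definition first_order_rigid ::
  "(real ^ 'n \<Rightarrow> real ^ 'n \<Rightarrow> real ^ 'n) \<Rightarrow> (real ^ 'n) set \<Rightarrow> nat set \<Rightarrow> nat set set \<Rightarrow>
   (nat \<Rightarrow> real ^ 'n) \<Rightarrow> bool" where
  "first_order_rigid k Y V E p \<longleftrightarrow>
     (\<forall>u. first_order_motion k V E p u \<longrightarrow>
        (\<exists>w. trivial_motion k Y w \<and> (\<forall>i\<in>V. u i = w (p i))))"

lemma first_order_motion_iff:
  assumes "finite V" and "graph V E"
  shows "first_order_motion k V E p u \<longleftrightarrow>
    (\<forall>i j. {i, j} \<in> E \<longrightarrow> k (p i) (p j) \<bullet> u i + k (p j) (p i) \<bullet> u j = 0)"
proof -
  have row: "(\<Sum>(m, a)\<in>cols V. rigidity_matrix k p {i, j} (m, a) * u m $ a) =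
      k (p i) (p j) \<bullet> u i + k (p j) (p i) \<bullet> u j"
    if "i \<in> V" "j \<in> V" "i \<noteq> j" for i j
  proof -
    have the: "(THE m. {i, j} = {i, m}) = j" "(THE m. {i, j} = {j, m}) = i"
      using that by (intro the_equality; simp add: doubleton_eq_iff)+
    let ?f = "\<lambda>m. \<Sum>a\<in>UNIV. rigidity_matrix k p {i, j} (m, a) * u m $ a"
    have "(\<Sum>(m, a)\<in>cols V. rigidity_matrix k p {i, j} (m, a) * u m $ a) = sum ?f V"
      unfolding cols_def by (simp add: sum.cartesian_product)
    also have "\<dots> = sum ?f {i, j}"
      using that assms(1)
      by (intro sum.mono_neutral_right) (auto simp: rigidity_matrix_def)
    also have "\<dots> = k (p i) (p j) \<bullet> u i + k (p j) (p i) \<bullet> u j"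
      using that by (simp add: rigidity_matrix_def the inner_vec_def)
    finally show ?thesis .
  qed
  show ?thesis
  proof
    assume L: "first_order_motion k V E p u"
    show "\<forall>i j. {i, j} \<in> E \<longrightarrow> k (p i) (p j) \<bullet> u i + k (p j) (p i) \<bullet> u j = 0"
    proof (intro allI impI)
      fix i j assume e: "{i, j} \<in> E"
      then obtain a b where ab: "{i, j} = {a, b}" "a \<in> V" "b \<in> V" "a \<noteq> b"
        using assms(2) unfolding graph_def by blast
      then have "i \<in> V" "j \<in> V" "i \<noteq> j"
        unfolding doubleton_eq_iff by blast+
      note row [OF this, symmetric]
      also have "(\<Sum>(m, a)\<in>cols V. rigidity_matrix k p {i, j} (m, a) * u m $ a) = 0"
        using L e unfolding first_order_motion_def by (rule bspec)
      finally show "k (p i) (p j) \<bullet> u i + k (p j) (p i) \<bullet> u j = 0" .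
    qed
  next
    assume R: "\<forall>i j. {i, j} \<in> E \<longrightarrow> k (p i) (p j) \<bullet> u i + k (p j) (p i) \<bullet> u j = 0"
    show "first_order_motion k V E p u"
      unfolding first_order_motion_def
    proof
      fix e assume "e \<in> E"
      then obtain i j where e: "e = {i, j}" and ij: "i \<in> V" "j \<in> V" "i \<noteq> j"
        using assms(2) unfolding graph_def by blast
      have "k (p i) (p j) \<bullet> u i + k (p j) (p i) \<bullet> u j = 0"
        using R \<open>e \<in> E\<close> unfolding e by blast
      with row [OF ij] show "(\<Sum>(m, a)\<in>cols V. rigidity_matrix k p e (m, a) * u m $ a) = 0"
        unfolding e by (rule trans)
    qed
  qed
qed

end

theory Submission
  imports Defs
begin

text \<open>
  The three geometries share their straight lines, and this is reflected in one identity: the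
  symmetric matrix \<open>T\<^sub>x = I + K x x\<^sup>T\<close> carries the coefficient vector of the curved geometry to the
  Euclidean one, \<open>T\<^sub>x k(x,y) = x - y\<close> (\<open>k_K_T_block\<close>). Read row by row this is the factorization
  of the rigidity matrices. Read by duality, \<open>k(x,y) \<bullet> T\<^sub>x u = (x - y) \<bullet> u\<close>, it says that
  \<open>u\<^sub>i \<mapsto> T\<^sub>x u\<^sub>i\<close> with \<open>x = p\<^sub>i\<close> turns Euclidean motions into motions of the curved geometry. Off the
  set \<open>1 + K x \<bullet> x = 0\<close> the rank one perturbation \<open>T\<^sub>x\<close> of the identity is invertible, so this is a
  bijection, both for motions of the framework and for trivial motions on a fixed point set \<open>Y\<close>.
  Hence rigidity in the curved geometry on \<open>Y\<close> is Euclidean rigidity in which the trivial motions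
  are only required to live on \<open>Y\<close> (\<open>first_order_rigid_k_K_iff_k_E\<close>).

  For the sphere \<open>Y\<close> is the whole space and nothing remains to be done. In the hyperbolic case \<open>Y\<close>
  omits the unit sphere, and a trivial Euclidean motion of \<open>Y\<close> could a priori fail to come from one
  of the whole space. It does come from one, since already a neighbourhood of the origin forces the
  motion to be \<open>x \<mapsto> A x + b\<close> with \<open>A\<close> skew-symmetric (\<open>trivial_motion_k_E_extends\<close>).
\<close>

section \<open>The map from Euclidean velocities to projective velocities\<close>

lemma T_block_mult: "T_block K x *v u = u + (K * (x \<bullet> u)) *\<^sub>R x"
proof -
  have "(\<Sum>b\<in>UNIV. ((if a = b then 1 else 0) + K * x $ a * x $ b) * u $ b)
      = u $ a + K * (\<Sum>b\<in>UNIV. x $ b * u $ b) * x $ a" for a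
  proof -
    have "(\<Sum>b\<in>UNIV. ((if a = b then 1 else 0) + K * x $ a * x $ b) * u $ b)
        = (\<Sum>b\<in>UNIV. (if a = b then u $ b else 0) + K * x $ a * (x $ b * u $ b))"
      by (intro sum.cong) (auto simp: algebra_simps)
    then show ?thesis
      by (simp add: sum.distrib sum_distrib_left [symmetric])
  qed
  then show ?thesis
    by (simp add: T_block_def matrix_vector_mult_def inner_vec_def vec_eq_iff)
qed

lemma transpose_T_block: "transpose (T_block K x) = T_block K x"
  by (simp add: T_block_def transpose_def vec_eq_iff mult.commute mult.left_commute)

text \<open>The coefficient of \<open>x\<close> in \<open>k_K K x y\<close> is the one for which the component that \<open>T_block K x\<close>
  adds along \<open>x\<close> restores the coefficient \<open>1\<close>.\<close>

lemma k_K_T_block: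
  assumes "1 + K * (x \<bullet> x) \<noteq> 0"
  shows "k_K K x y v* T_block K x = k_E x y"
proof -
  define c where "c = (1 + K * (x \<bullet> y)) / (1 + K * (x \<bullet> x))"
  have "c * (1 + K * (x \<bullet> x)) = 1 + K * (x \<bullet> y)"
    using assms by (simp add: c_def)
  then have c: "c + K * (x \<bullet> (c *\<^sub>R x - y)) = 1"
    by (simp add: algebra_simps inner_diff_right)
  have "k_K K x y v* T_block K x = T_block K x *v (c *\<^sub>R x - y)"
    by (metis k_K_def c_def transpose_T_block transpose_matrix_vector)
  also have "\<dots> = (c + K * (x \<bullet> (c *\<^sub>R x - y))) *\<^sub>R x - y"
    by (simp add: T_block_mult scaleR_add_left)
  also have "\<dots> = k_E x y"
    by (simp add: c k_E_def)
  finally show ?thesis .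
qed

lemma k_K_inner_T_block:
  assumes "1 + K * (x \<bullet> x) \<noteq> 0"
  shows "k_K K x y \<bullet> (T_block K x *v u) = k_E x y \<bullet> u"
  using k_K_T_block [OF assms, of y] by (metis dot_lmul_matrix)

text \<open>The Sherman--Morrison inverse of the rank one perturbation \<open>T_block K x\<close>.\<close>

definition T_inv :: "real \<Rightarrow> real ^ 'n \<Rightarrow> real ^ 'n \<Rightarrow> real ^ 'n" where
  "T_inv K x u = u - (K * (x \<bullet> u) / (1 + K * (x \<bullet> x))) *\<^sub>R x"

lemma T_block_T_inv:
  assumes "1 + K * (x \<bullet> x) \<noteq> 0"
  shows "T_block K x *v T_inv K x u = u"
proof -
  define d where "d = K * (x \<bullet> u) / (1 + K * (x \<bullet> x))"
  have "d * (1 + K * (x \<bullet> x)) = K * (x \<bullet> u)"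
    using assms by (simp add: d_def)
  then have d: "K * (x \<bullet> (u - d *\<^sub>R x)) = d"
    by (simp add: algebra_simps inner_diff_right)
  show ?thesis
    unfolding T_inv_def d_def [symmetric] T_block_mult d by simp
qed

lemma T_inv_T_block:
  assumes "1 + K * (x \<bullet> x) \<noteq> 0"
  shows "T_inv K x (T_block K x *v u) = u"
proof -
  have "K * (x \<bullet> (u + (K * (x \<bullet> u)) *\<^sub>R x)) = K * (x \<bullet> u) * (1 + K * (x \<bullet> x))"
    by (simp add: algebra_simps inner_add_right)
  then have "K * (x \<bullet> (u + (K * (x \<bullet> u)) *\<^sub>R x)) / (1 + K * (x \<bullet> x)) = K * (x \<bullet> u)"
    using assms by (metis nonzero_mult_div_cancel_right)
  then show ?thesis
    unfolding T_inv_def T_block_mult by simp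
qed

lemma k_E_inner_T_inv:
  assumes "1 + K * (x \<bullet> x) \<noteq> 0"
  shows "k_E x y \<bullet> T_inv K x u = k_K K x y \<bullet> u"
  using k_K_inner_T_block [OF assms, of y "T_inv K x u"]
  by (simp add: T_block_T_inv [OF assms])

section \<open>The factorization of the rigidity matrices\<close>

lemma rigidity_matrix_mult_T_mat:
  fixes p :: "nat \<Rightarrow> real ^ 'n"
  assumes "finite V" and nz: "\<And>i. i \<in> V \<Longrightarrow> 1 + K * (p i \<bullet> p i) \<noteq> 0"
  shows "mat_eq_on E (cols V)
    (mat_mult_on (cols V) (rigidity_matrix (k_K K) p) (T_mat K p)) (rigidity_matrix k_E p)"
  unfolding mat_eq_on_def
proof (intro ballI)
  fix e and c :: "nat \<times> 'n" assume "c \<in> cols V"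
  then obtain j b where c: "c = (j, b)" and j: "j \<in> V"
    by (auto simp: cols_def)
  let ?R = "rigidity_matrix (k_K K) p e"
  have "mat_mult_on (cols V) (rigidity_matrix (k_K K) p) (T_mat K p) e c
      = (\<Sum>i\<in>V. \<Sum>a\<in>UNIV. ?R (i, a) * T_mat K p (i, a) (j, b))"
    by (simp add: mat_mult_on_def cols_def c sum.cartesian_product split_def)
  also have "\<dots> = (\<Sum>i\<in>V. if i = j then \<Sum>a\<in>UNIV. ?R (j, a) * T_block K (p j) $ a $ b else 0)"
    by (intro sum.cong) (auto simp: T_mat_def)
  also have "\<dots> = (\<Sum>a\<in>UNIV. ?R (j, a) * T_block K (p j) $ a $ b)"
    using assms(1) j by simp
  also have "\<dots> = rigidity_matrix k_E p e c"
  proof (cases "j \<in> e")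
    case True
    define q where "q = p (THE i. e = {j, i})"
    have "(\<Sum>a\<in>UNIV. ?R (j, a) * T_block K (p j) $ a $ b)
        = (k_K K (p j) q v* T_block K (p j)) $ b"
      using True
      by (simp add: rigidity_matrix_def q_def vector_matrix_mult_def mult.commute)
    with True show ?thesis
      by (simp add: k_K_T_block [OF nz [OF j]] c rigidity_matrix_def q_def)
  next
    case False
    then show ?thesis
      by (simp add: rigidity_matrix_def c)
  qed
  finally show "mat_mult_on (cols V) (rigidity_matrix (k_K K) p) (T_mat K p) e c
      = rigidity_matrix k_E p e c" .
qed

section \<open>Transfer of rigidity on a fixed point set\<close>

text \<open>Applying \<open>T_block\<close> or its inverse at each point preserves the defining equation of a motion
  term by term, so that motions of the framework and trivial motions on \<open>Y\<close> correspond in the same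
  way.\<close>

lemma first_order_rigid_k_K_iff_k_E:
  assumes "finite V" and G: "graph V E"
    and nz: "\<And>x. x \<in> Y \<Longrightarrow> 1 + K * (x \<bullet> x) \<noteq> 0"
    and p: "\<And>i. i \<in> V \<Longrightarrow> p i \<in> Y"
  shows "first_order_rigid (k_K K) Y V E p \<longleftrightarrow> first_order_rigid k_E Y V E p"
proof -
  have edge: "p i \<in> Y" "p j \<in> Y" if "{i, j} \<in> E" for i j
  proof -
    have "i \<in> V \<and> j \<in> V"
      using that G unfolding graph_def by (auto simp: doubleton_eq_iff)
    then show "p i \<in> Y" "p j \<in> Y"
      using p by auto
  qed
  note motion = first_order_motion_iff [OF assms(1) G]
  show ?thesis
  proof
    assume R: "first_order_rigid (k_K K) Y V E p"
    show "first_order_rigid k_E Y V E p"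
      unfolding first_order_rigid_def
    proof (intro allI impI)
      fix u assume "first_order_motion k_E V E p u"
      then have "first_order_motion (k_K K) V E p (\<lambda>i. T_block K (p i) *v u i)"
        unfolding motion by (auto simp: k_K_inner_T_block nz edge)
      with R obtain w where w: "trivial_motion (k_K K) Y w"
        and u: "\<And>i. i \<in> V \<Longrightarrow> T_block K (p i) *v u i = w (p i)"
        unfolding first_order_rigid_def by blast
      have "trivial_motion k_E Y (\<lambda>x. T_inv K x (w x))"
        using w unfolding trivial_motion_def by (auto simp: k_E_inner_T_inv nz)
      moreover have "u i = T_inv K (p i) (w (p i))" if "i \<in> V" for i
        using u [OF that] T_inv_T_block [OF nz [OF p [OF that]], of "u i"] by simp
      ultimately show "\<exists>w. trivial_motion k_E Y w \<and> (\<forall>i\<in>V. u i = w (p i))"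
        by blast
    qed
  next
    assume R: "first_order_rigid k_E Y V E p"
    show "first_order_rigid (k_K K) Y V E p"
      unfolding first_order_rigid_def
    proof (intro allI impI)
      fix u assume "first_order_motion (k_K K) V E p u"
      then have "first_order_motion k_E V E p (\<lambda>i. T_inv K (p i) (u i))"
        unfolding motion by (auto simp: k_E_inner_T_inv nz edge)
      with R obtain w where w: "trivial_motion k_E Y w"
        and u: "\<And>i. i \<in> V \<Longrightarrow> T_inv K (p i) (u i) = w (p i)"
        unfolding first_order_rigid_def by blast
      have "trivial_motion (k_K K) Y (\<lambda>x. T_block K x *v w x)"
        using w unfolding trivial_motion_def by (auto simp: k_K_inner_T_block nz)
      moreover have "u i = T_block K (p i) *v w (p i)" if "i \<in> V" for i
        using u [OF that] T_block_T_inv [OF nz [OF p [OF that]], of "u i"] by simp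
      ultimately show "\<exists>w. trivial_motion (k_K K) Y w \<and> (\<forall>i\<in>V. u i = w (p i))"
        by blast
    qed
  qed
qed

section \<open>Extension of trivial Euclidean motions\<close>

text \<open>Subtract \<open>w 0\<close> to get \<open>f\<close> with \<open>x \<bullet> f x = 0\<close> and hence \<open>x \<bullet> f y = - (y \<bullet> f x)\<close> on \<open>Y\<close>. Taking
  for \<open>y\<close> small multiples of the basis vectors determines all coordinates of \<open>f x\<close> as linear
  functions of \<open>x\<close>, and the linear map so obtained makes sense on the whole space. It is
  skew-symmetric because \<open>x \<bullet> f x = 0\<close> holds near the origin and is homogeneous in \<open>x\<close>.\<close>

lemma trivial_motion_k_E_extends:
  fixes Y :: "(real ^ 'n) set"
  assumes Y: "0 \<in> interior Y" and w: "trivial_motion k_E Y w"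
  obtains w' where "trivial_motion k_E UNIV w'" and "\<And>x. x \<in> Y \<Longrightarrow> w' x = w x"
proof -
  obtain r where r: "r > 0" and ball: "cball 0 r \<subseteq> Y"
    using Y by (auto simp: mem_interior_cball)
  define f where "f x = w x - w 0" for x
  have 0: "0 \<in> Y"
    using ball r by auto
  have orth: "x \<bullet> f x = 0" if "x \<in> Y" for x
    using w that 0 unfolding trivial_motion_def f_def k_E_def
    by (force simp: inner_diff_left inner_diff_right)
  have skew: "x \<bullet> f y = - (y \<bullet> f x)" if "x \<in> Y" "y \<in> Y" for x y
  proof -
    have "(x - y) \<bullet> w x + (y - x) \<bullet> w y = 0"
      using w that unfolding trivial_motion_def k_E_def by blast
    then have "(x - y) \<bullet> f x + (y - x) \<bullet> f y = 0"
      by (simp add: f_def inner_diff_left inner_diff_right)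
    with orth that show ?thesis
      by (simp add: inner_diff_left)
  qed
  define g :: "real ^ 'n \<Rightarrow> real ^ 'n"
    where "g x = (\<chi> a. - (x \<bullet> f (r *\<^sub>R axis a 1)) / r)" for x
  have g_diff: "g (x - y) = g x - g y" for x y
    by (simp add: g_def vec_eq_iff inner_diff_left diff_divide_distrib)
  have g_scale: "g (c *\<^sub>R x) = c *\<^sub>R g x" for c x
    by (simp add: g_def vec_eq_iff)
  have g_eq: "g x = f x" if "x \<in> Y" for x
  proof -
    have "r *\<^sub>R axis a 1 \<in> Y" for a :: 'n
      using ball r by (auto simp: subset_iff)
    from skew [OF that this] show ?thesis
      using r by (simp add: g_def vec_eq_iff inner_axis')
  qed
  have g_orth: "x \<bullet> g x = 0" for x
  proof (cases "x = 0")
    case False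
    define c where "c = r / norm x"
    have "c > 0" "c *\<^sub>R x \<in> Y"
      using False r ball by (auto simp: c_def subset_iff)
    then have "(c *\<^sub>R x) \<bullet> (c *\<^sub>R g x) = 0"
      using orth g_eq by (metis g_scale)
    with \<open>c > 0\<close> show ?thesis
      by simp
  qed simp
  have "k_E x y \<bullet> (w 0 + g x) + k_E y x \<bullet> (w 0 + g y) = (x - y) \<bullet> g (x - y)" for x y
    by (simp add: k_E_def g_diff inner_diff_left inner_diff_right inner_add_right)
  then have "trivial_motion k_E UNIV (\<lambda>x. w 0 + g x)"
    by (simp add: trivial_motion_def g_orth)
  moreover have "w 0 + g x = w x" if "x \<in> Y" for x
    using g_eq [OF that] by (simp add: f_def)
  ultimately show thesis
    by (rule that)
qed

lemma first_order_rigid_k_E_iff_UNIV: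
  assumes "0 \<in> interior Y" and "\<And>i. i \<in> V \<Longrightarrow> p i \<in> Y"
  shows "first_order_rigid k_E Y V E p \<longleftrightarrow> first_order_rigid k_E UNIV V E p"
proof
  assume "first_order_rigid k_E Y V E p"
  then show "first_order_rigid k_E UNIV V E p"
    unfolding first_order_rigid_def
    using trivial_motion_k_E_extends [OF assms(1)] assms(2) by metis
next
  assume "first_order_rigid k_E UNIV V E p"
  then show "first_order_rigid k_E Y V E p"
    unfolding first_order_rigid_def trivial_motion_def by blast
qed

section \<open>Rigidity in the three geometries\<close>

lemma zero_in_interior_off_absolute: "0 \<in> interior (PH \<union> PD)"
proof -
  have "ball 0 1 \<subseteq> PH \<union> PD"
    by (auto simp: PH_def dot_square_norm power_less_one_iff)
  then show ?thesis
    by (auto simp: mem_interior intro: exI [of _ 1])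
qed

theorem mainTheorem4:
  fixes v :: nat and E :: "nat set set" and p :: "nat \<Rightarrow> real ^ 'n"
  assumes V: "V = {1..v}" and G: "graph V E"
  shows
    "(mat_eq_on E (cols V)
        (mat_mult_on (cols V) (rigidity_matrix (k_K 1) p) (T_mat 1 p))
        (rigidity_matrix k_E p) \<and>
      ((\<forall>i\<in>V. p i \<bullet> p i \<noteq> 1) \<longrightarrow>
        mat_eq_on E (cols V)
          (mat_mult_on (cols V) (rigidity_matrix (k_K (- 1)) p) (T_mat (- 1) p))
          (rigidity_matrix k_E p))) \<and>
     (first_order_rigid (k_K 1) PS_plus V E p \<longleftrightarrow> first_order_rigid k_E UNIV V E p) \<and>
     (framework (PH \<union> PD) V p \<and> first_order_rigid (k_K (- 1)) (PH \<union> PD) V E p \<longleftrightarrow>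
      first_order_rigid k_E UNIV V E p \<and> (\<forall>i\<in>V. p i \<bullet> p i \<noteq> 1))"
proof -
  have fin: "finite V"
    by (simp add: V)
  have sph: "1 + 1 * (x \<bullet> x) \<noteq> 0" for x :: "real ^ 'n"
    by (smt (verit) inner_ge_zero)
  have off: "x \<in> PH \<union> PD \<longleftrightarrow> x \<bullet> x \<noteq> 1" for x :: "real ^ 'n"
    by (auto simp: PH_def PD_def)
  have hyp: "1 + (- 1) * (x \<bullet> x) \<noteq> 0" if "x \<in> PH \<union> PD" for x :: "real ^ 'n"
    using that unfolding off by simp
  have fw: "framework (PH \<union> PD) V p \<longleftrightarrow> (\<forall>i\<in>V. p i \<bullet> p i \<noteq> 1)"
    unfolding framework_def off ..
  have "mat_eq_on E (cols V)
      (mat_mult_on (cols V) (rigidity_matrix (k_K 1) p) (T_mat 1 p)) (rigidity_matrix k_E p)"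
    by (intro rigidity_matrix_mult_T_mat fin sph)
  moreover have "mat_eq_on E (cols V)
      (mat_mult_on (cols V) (rigidity_matrix (k_K (- 1)) p) (T_mat (- 1) p))
      (rigidity_matrix k_E p)" if "\<forall>i\<in>V. p i \<bullet> p i \<noteq> 1"
    using that by (intro rigidity_matrix_mult_T_mat fin hyp) (simp add: off del: Un_iff)
  moreover have "first_order_rigid (k_K 1) PS_plus V E p \<longleftrightarrow> first_order_rigid k_E UNIV V E p"
    unfolding PS_plus_def by (intro first_order_rigid_k_K_iff_k_E fin G sph) simp
  moreover have "first_order_rigid (k_K (- 1)) (PH \<union> PD) V E p
      \<longleftrightarrow> first_order_rigid k_E UNIV V E p" if "framework (PH \<union> PD) V p"
  proof -
    have p: "p i \<in> PH \<union> PD" if "i \<in> V" for i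
      using \<open>framework (PH \<union> PD) V p\<close> that unfolding framework_def by blast
    have "first_order_rigid (k_K (- 1)) (PH \<union> PD) V E p
        \<longleftrightarrow> first_order_rigid k_E (PH \<union> PD) V E p"
      by (intro first_order_rigid_k_K_iff_k_E fin G hyp p)
    also have "\<dots> \<longleftrightarrow> first_order_rigid k_E UNIV V E p"
      by (intro first_order_rigid_k_E_iff_UNIV zero_in_interior_off_absolute p)
    finally show ?thesis .
  qed
  ultimately show ?thesis
    using fw by blast
qed

end
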